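(* Let $m,n,s$ be integers with $1\leq m<n$ and $1\leq s\leq n-1$, let $M\in\mathbb{R}^{m\times n}$ and $p\in\mathbb{R}^m$, and let $X=\mathbb{R}^n$. Let $\mathcal{J}_s$ be the set of all subsets $J$ of $\{1,\ldots,n\}$ with exactly $s$ elements; for $J\in\mathcal{J}_s$ let $A_J:=\operatorname{span}\{e_j : j\in J\}$. Set $$A:=\bigcup_{J\in\mathcal{J}_s}A_J=\{x\in\mathbb{R}^n : \|x\|_0\leq s\},\qquad B:=\{x\in\mathbb{R}^n : Mx=p\},$$ $$\mathcal{A}:=\widetilde{\mathcal{A}}:=(A_J)_{J\in\mathcal{J}_s},\qquad \mathcal{B}:=\widetilde{\mathcal{B}}:=(B)\ \text{ (the collection with the single member } B).$$ Suppose that $c\in A\cap B$, set $$\overline{\delta}:=\tfrac13\min\{d_{A_J}(c) : c\notin A_J,\ J\in\mathcal{J}_s\},$$ and fix $\delta\in\,]0,\overline{\delta}[$. Then $$\overline{\delta}=\tfrac13\min\{|c_j| : j\in I(c)\}$$ and $$\overline{\alpha}=\overline{\theta}=\theta_{3\delta}(\mathcal{A},\widetilde{\mathcal{A}},\mathcal{B},\widetilde{\mathcal{B}})=\max\{c(A_J,B) : c\in A_J,\ J\in\mathcal{J}_s\}<1,$$ where $\theta_{3\delta}$, $\overline{\theta}$ and $\overline{\alpha}$ denote, respectively, the joint-CQ-number (with parameter $3\delta$), the limiting joint-CQ-number and the exact joint-CQ-number at $c$ associated with $(\mathcal{A},\widetilde{\mathcal{A}},\mathcal{B},\widetilde{\mathcal{B}})$,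 and $c(A_J,B)$ is the cosine of the Friedrichs angle between $A_J$ and $B$. Suppose in addition that $b_{-1}\in X$ satisfies $$\|b_{-1}-c\|\leq\frac{(1-\overline{\theta})\delta}{6(2-\overline{\theta})},$$ and let $(a_k)_{k\in\mathbb{N}}$, $(b_k)_{k\in\mathbb{N}}$ be sequences generated by the method of alternating projections, i.e., $a_k\in P_A(b_{k-1})$ and $b_k=P_B(a_k)$ for every $k\in\mathbb{N}=\{0,1,2,\ldots\}$. Then $(a_k)_{k\in\mathbb{N}}$ and $(b_k)_{k\in\mathbb{N}}$ converge linearly to some point $\bar{c}\in A\cap B$ with $\|\bar c-c\|\leq\delta$, with rate $\overline{\theta}^2$.
   Context: $X=\mathbb{R}^n$ has the Euclidean inner product $\langle\cdot,\cdot\rangle$ and norm $\|\cdot\|$; $e_1,\dots,e_n$ are the standard unit vectors. For $x\in\mathbb{R}^n$, $I(x):=\{i : x_i\neq 0\}$ and $\|x\|_0:=\operatorname{card} I(x)$. For nonempty $S\subseteq X$: $d_S(x):=\inf_{y\in S}\|x-y\|$, $P_S(x):=\{y\in S : \|x-y\|=d_S(x)\}$, $P_S^{-1}(a):=\{x\in X : a\in P_S(x)\}$ (when $P_S(x)$ is a singleton it is identified with its element). $\operatorname{cone}(S):=\{\rho y : \rho\geq 0, y\in S\}$ if $S\neq\varnothing$ and $\operatorname{cone}(\varnothing):=\{0\}$. Conventions: $\sup\varnothing=-\infty$, $\min\varnothing=+\infty$. Restricted normal cones: for nonempty $C,D\subseteq X$ and $a\in C$, the $D$-restricted proximal normal cone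 of $C$ at $a$ is $\widehat{N}_C^D(a):=\operatorname{cone}\big((D\cap P_C^{-1}(a))-a\big)$. The $D$-restricted normal cone $N_C^D(a)$ consists of all $u$ for which there are sequences $a_k\in C$ and $u_k\in\widehat{N}_C^D(a_k)$ with $a_k\to a$ and $u_k\to u$. If $a\notin C$, both cones are empty. CQ-numbers: for nonempty sets $C,\widetilde{C},D,\widetilde{D}\subseteq X$, a point $c\in X$ and $\delta>0$, the CQ-number at $c$ is $$\theta_\delta(C,\widetilde{C},D,\widetilde{D}):=\sup\{\langle u,v\rangle : u\in\widehat{N}_C^{\widetilde{D}}(a),\ v\in-\widehat{N}_D^{\widetilde{C}}(b),\ \|u\|\leq1,\|v\|\leq1,\ \|a-c\|\leq\delta,\|b-c\|\leq\delta\}.$$ The exact CQ-number at $c$ is $$\overline{\alpha}(C,\widetilde{C},D,\widetilde{D}):=\sup\{\langle u,v\rangle : u\in N_C^{\widetilde{D}}(c),\ v\in-N_D^{\widetilde{C}}(c),\ \|u\|\leq1,\|v\|\leq1\},$$ which is $-\infty$ if $c\notin C\cap D$. For collections $\mathcal{C}=(C_i)_{i\in I}$, $\widetilde{\mathcal{C}}=(\widetilde{C}_i)_{i\in I}$, $\mathcal{D}=(D_j)_{j\in J}$, $\widetilde{\mathcal{D}}=(\widetilde{D}_j)_{j\in J}$ of nonempty sets, the joint-CQ-number $\theta_\delta(\mathcal{C},\widetilde{\mathcal{C}},\mathcal{D},\widetilde{\mathcal{D}})$ at $c$ is $\sup_{(i,j)\in I\times J}\theta_\delta(C_i,\widetilde{C}_i,D_j,\widetilde{D}_j)$;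 the limiting joint-CQ-number is $\overline{\theta}:=\lim_{\delta\downarrow0}\theta_\delta(\mathcal{C},\widetilde{\mathcal{C}},\mathcal{D},\widetilde{\mathcal{D}})$; the exact joint-CQ-number is $\overline{\alpha}:=\sup_{(i,j)\in I\times J}\overline{\alpha}(C_i,\widetilde{C}_i,D_j,\widetilde{D}_j)$. Friedrichs angle: for linear subspaces $U,V$ of $X$, $c(U,V):=\sup\{|\langle u,v\rangle| : u\in U\cap(U\cap V)^\perp,\ v\in V\cap(U\cap V)^\perp,\ \|u\|\leq1,\|v\|\leq1\}$. For intersecting affine subspaces, $c(U,V)$ is defined as $c$ of the parallel linear subspaces. "Converge linearly to $\bar c$ with rate $\overline{\theta}^2$" means: there is a constant $C\geq 0$ such that $\max\{\|a_k-\bar c\|,\|b_k-\bar c\|\}\leq C\,(\overline{\theta}^2)^{k-1}$ for all $k\geq1$ (with $0^0=1$). *)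

theory Defs
  imports "HOL-Analysis.Analysis"
begin

section \<open>Projections and restricted normal cones\<close>

definition proj :: "'a::euclidean_space set \<Rightarrow> 'a \<Rightarrow> 'a set" where
  "proj S x = {y \<in> S. norm (x - y) = infdist x S}"

definition proj_inv :: "'a::euclidean_space set \<Rightarrow> 'a \<Rightarrow> 'a set" where
  "proj_inv S a = {x. a \<in> proj S x}"

(* Not the library's "cone hull", which is empty on the empty set. *)
definition cone_of :: "'a::euclidean_space set \<Rightarrow> 'a set" where
  "cone_of S = (if S = {} then {0} else {\<rho> *\<^sub>R y | \<rho> y. 0 \<le> \<rho> \<and> y \<in> S})"

definition prox_normal_cone :: "'a::euclidean_space set \<Rightarrow> 'a set \<Rightarrow> 'a \<Rightarrow> 'a set" where
  "prox_normal_cone C D a =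
     (if a \<in> C then cone_of ((\<lambda>x. x - a) ` (D \<inter> proj_inv C a)) else {})"

definition normal_cone :: "'a::euclidean_space set \<Rightarrow> 'a set \<Rightarrow> 'a \<Rightarrow> 'a set" where
  "normal_cone C D a =
     (if a \<in> C
      then {u. \<exists>x w. (\<forall>k. x k \<in> C \<and> w k \<in> prox_normal_cone C D (x k))
                   \<and> x \<longlonglongrightarrow> a \<and> w \<longlonglongrightarrow> u}
      else {})"


section \<open>CQ-numbers\<close>

(* Suprema are taken in ereal, so that the supremum of the empty set is -\<infinity>.
   The order of the set arguments is C, C~, D, D~. *)

definition CQ_number ::
  "'a::euclidean_space \<Rightarrow> real \<Rightarrow> 'a set \<Rightarrow> 'a set \<Rightarrow> 'a set \<Rightarrow> 'a set \<Rightarrow> ereal" where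
  "CQ_number c \<delta> C C' D D' =
     Sup {ereal (u \<bullet> v) | u v a b.
            u \<in> prox_normal_cone C D' a \<and> v \<in> uminus ` prox_normal_cone D C' b \<and>
            norm u \<le> 1 \<and> norm v \<le> 1 \<and> norm (a - c) \<le> \<delta> \<and> norm (b - c) \<le> \<delta>}"

definition exact_CQ_number ::
  "'a::euclidean_space \<Rightarrow> 'a set \<Rightarrow> 'a set \<Rightarrow> 'a set \<Rightarrow> 'a set \<Rightarrow> ereal" where
  "exact_CQ_number c C C' D D' =
     Sup {ereal (u \<bullet> v) | u v.
            u \<in> normal_cone C D' c \<and> v \<in> uminus ` normal_cone D C' c \<and>
            norm u \<le> 1 \<and> norm v \<le> 1}"

(* Collections are families indexed by the sets I and J. *)

definition joint_CQ_number ::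
  "'a::euclidean_space \<Rightarrow> real \<Rightarrow> 'i set \<Rightarrow> 'j set \<Rightarrow>
   ('i \<Rightarrow> 'a set) \<Rightarrow> ('i \<Rightarrow> 'a set) \<Rightarrow> ('j \<Rightarrow> 'a set) \<Rightarrow> ('j \<Rightarrow> 'a set) \<Rightarrow> ereal" where
  "joint_CQ_number c \<delta> I J C C' D D' =
     (SUP (i, j) \<in> I \<times> J. CQ_number c \<delta> (C i) (C' i) (D j) (D' j))"

(* The limit always exists: joint_CQ_number is nondecreasing in \<delta>. *)
definition limiting_joint_CQ_number ::
  "'a::euclidean_space \<Rightarrow> 'i set \<Rightarrow> 'j set \<Rightarrow>
   ('i \<Rightarrow> 'a set) \<Rightarrow> ('i \<Rightarrow> 'a set) \<Rightarrow> ('j \<Rightarrow> 'a set) \<Rightarrow> ('j \<Rightarrow> 'a set) \<Rightarrow> ereal" where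
  "limiting_joint_CQ_number c I J C C' D D' =
     Lim (at_right 0) (\<lambda>\<delta>. joint_CQ_number c \<delta> I J C C' D D')"

definition exact_joint_CQ_number ::
  "'a::euclidean_space \<Rightarrow> 'i set \<Rightarrow> 'j set \<Rightarrow>
   ('i \<Rightarrow> 'a set) \<Rightarrow> ('i \<Rightarrow> 'a set) \<Rightarrow> ('j \<Rightarrow> 'a set) \<Rightarrow> ('j \<Rightarrow> 'a set) \<Rightarrow> ereal" where
  "exact_joint_CQ_number c I J C C' D D' =
     (SUP (i, j) \<in> I \<times> J. exact_CQ_number c (C i) (C' i) (D j) (D' j))"


section \<open>Friedrichs angle\<close>

(* A real supremum: the set contains 0 and is bounded above by 1. *)
definition friedrichs_linear :: "'a::euclidean_space set \<Rightarrow> 'a set \<Rightarrow> real" where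
  "friedrichs_linear U V =
     Sup {\<bar>u \<bullet> v\<bar> | u v.
            u \<in> U \<inter> orthogonal_comp (U \<inter> V) \<and> v \<in> V \<inter> orthogonal_comp (U \<inter> V) \<and>
            norm u \<le> 1 \<and> norm v \<le> 1}"

(* Unique for nonempty affine U. *)
definition parallel_subspace :: "'a::euclidean_space set \<Rightarrow> 'a set" where
  "parallel_subspace U = (THE L. subspace L \<and> affine_parallel U L)"

definition friedrichs :: "'a::euclidean_space set \<Rightarrow> 'a set \<Rightarrow> real" where
  "friedrichs U V = friedrichs_linear (parallel_subspace U) (parallel_subspace V)"


section \<open>Sparse vectors\<close>

definition supp :: "real ^ 'n \<Rightarrow> 'n set" where
  "supp x = {i. x $ i \<noteq> 0}"

definition l0norm :: "real ^ 'n \<Rightarrow> nat" where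
  "l0norm x = card (supp x)"

definition coord_subspace :: "'n set \<Rightarrow> (real ^ 'n) set" where
  "coord_subspace J = span ((\<lambda>j. axis j 1) ` J)"


section \<open>Alternating projections\<close>

(* y is the iterate with index -1. *)
definition MAP_sequences ::
  "'a::euclidean_space set \<Rightarrow> 'a set \<Rightarrow> 'a \<Rightarrow> (nat \<Rightarrow> 'a) \<Rightarrow> (nat \<Rightarrow> 'a) \<Rightarrow> bool" where
  "MAP_sequences A B y a b \<longleftrightarrow>
     (\<forall>k. a k \<in> proj A (case k of 0 \<Rightarrow> y | Suc i \<Rightarrow> b i) \<and> proj B (a k) = {b k})"

definition converge_linearly ::
  "(nat \<Rightarrow> 'a::euclidean_space) \<Rightarrow> (nat \<Rightarrow> 'a) \<Rightarrow> 'a \<Rightarrow> real \<Rightarrow> bool" where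
  "converge_linearly a b z r \<longleftrightarrow>
     (\<exists>K\<ge>0. \<forall>k\<ge>1. max (norm (a k - z)) (norm (b k - z)) \<le> K * r ^ (k - 1))"

end

theory Submission
  imports Defs
begin

text \<open>Everything reduces to one fact about two subspaces \<open>U\<close>, \<open>V\<close> with Friedrichs cosine \<open>\<kappa> < 1\<close>: their
  orthogonal complements relative to \<open>U + V\<close> form the same angle, that is, the supremum of \<open>w \<bullet> z\<close> over the
  unit balls of \<open>U\<^sup>\<bottom> \<inter> (U + V)\<close> and \<open>V\<^sup>\<bottom> \<inter> (U + V)\<close> is again \<open>\<kappa>\<close>. The upper bound comes from
  \<open>orthogonal_residual_contracts\<close>: the component orthogonal to \<open>V\<close> of a vector of \<open>U\<^sup>\<bottom> \<inter> (U + V)\<close> is shorter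
  by the factor \<open>\<kappa>\<close>. Equality holds at the residuals \<open>v - \<kappa> u\<close> and \<open>\<kappa> v - u\<close> of an optimal pair \<open>(u, v)\<close>.

  For affine sets \<open>C\<close>, \<open>D\<close> through \<open>c\<close> with directions \<open>U\<close>, \<open>V\<close>, the \<open>D\<close>-restricted proximal normals of
  \<open>C\<close> lie in \<open>U\<^sup>\<bottom> \<inter> (U + V)\<close>, and each vector of that space is such a normal at points arbitrarily close
  to \<open>c\<close>. Hence the CQ-numbers of every radius and the exact CQ-number all equal the Friedrichs cosine. A
  coordinate subspace that misses \<open>c\<close> is further than \<open>3 \<delta>\<close> from \<open>c\<close>, so it contributes \<open>- \<infinity>\<close>, and each joint
  number is the maximum \<open>\<theta>\<close> over the finitely many coordinate subspaces through \<open>c\<close>.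

  For alternating projections started near \<open>c\<close>, each projection onto \<open>A\<close> is in fact a projection onto some
  coordinate subspace through \<open>c\<close>. Such projections, like those onto \<open>B\<close>, do not increase the distance to
  \<open>c\<close>, so this situation persists along the whole sequence although the subspace may change from step to
  step. The two gaps in one round, \<open>dist (a (Suc k)) (b (Suc k))\<close> and \<open>dist (b (Suc k)) (a (Suc (Suc k)))\<close>,
  each shrink by the factor \<open>\<theta>\<close>: the first because \<open>orthogonal_residual_contracts\<close> applies to the current
  subspace, the second because the next iterate is no further from \<open>b (Suc k)\<close> than its projection onto that
  same subspace, where the contraction applies with the two sets exchanged. Summing the resulting geometric series of ratio \<open>\<theta>\<^sup>2\<close> gives the limit and the rate.\<close>

section \<open>The Friedrichs angle of two subspaces\<close>

lemma orthogonal_comp_iff: "x \<in> U\<^sup>\<bottom> \<longleftrightarrow> (\<forall>u\<in>U. u \<bullet> x = 0)"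
  by (auto simp: orthogonal_comp_def orthogonal_def)

lemma friedrichs_linear_commute: "friedrichs_linear U V = friedrichs_linear V U"
proof -
  have "{\<bar>u \<bullet> v\<bar> | u v. u \<in> U \<inter> (U \<inter> V)\<^sup>\<bottom> \<and> v \<in> V \<inter> (U \<inter> V)\<^sup>\<bottom> \<and> norm u \<le> 1 \<and> norm v \<le> 1}
      = {\<bar>u \<bullet> v\<bar> | u v. u \<in> V \<inter> (V \<inter> U)\<^sup>\<bottom> \<and> v \<in> U \<inter> (V \<inter> U)\<^sup>\<bottom> \<and> norm u \<le> 1 \<and> norm v \<le> 1}"
    by (intro Collect_cong) (metis Int_commute inner_commute)
  then show ?thesis
    by (simp add: friedrichs_linear_def)
qed

lemma friedrichs_linear_attained:
  fixes U V :: "'a::euclidean_space set"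
  assumes "subspace U" "subspace V"
  obtains u v where "u \<in> U \<inter> (U \<inter> V)\<^sup>\<bottom>" "v \<in> V \<inter> (U \<inter> V)\<^sup>\<bottom>" "norm u \<le> 1" "norm v \<le> 1"
    "u \<bullet> v = friedrichs_linear U V"
    "\<And>x y. x \<in> U \<inter> (U \<inter> V)\<^sup>\<bottom> \<Longrightarrow> y \<in> V \<inter> (U \<inter> V)\<^sup>\<bottom> \<Longrightarrow> norm x \<le> 1 \<Longrightarrow> norm y \<le> 1
      \<Longrightarrow> \<bar>x \<bullet> y\<bar> \<le> friedrichs_linear U V"
proof -
  let ?U = "U \<inter> (U \<inter> V)\<^sup>\<bottom>" and ?V = "V \<inter> (U \<inter> V)\<^sup>\<bottom>"
  let ?S = "(?U \<inter> cball 0 1) \<times> (?V \<inter> cball 0 1)"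
  let ?f = "\<lambda>(x, y). \<bar>x \<bullet> y\<bar>"
  have sub: "subspace ?U" "subspace ?V"
    using assms by (simp_all add: subspace_inter subspace_orthogonal_comp)
  then have "compact ?S"
    by (intro compact_Times closed_Int_compact closed_subspace) auto
  moreover have "?S \<noteq> {}"
    using subspace_0[OF sub(1)] subspace_0[OF sub(2)] by auto
  moreover have "continuous_on ?S ?f"
    by (auto simp: case_prod_unfold intro!: continuous_intros)
  ultimately obtain z where z: "z \<in> ?S" "\<And>w. w \<in> ?S \<Longrightarrow> ?f w \<le> ?f z"
    using continuous_attains_sup[of ?S ?f] by blast
  obtain u v where uv: "z = (u, v)" by (cases z)
  have u: "u \<in> ?U" "norm u \<le> 1" and v: "v \<in> ?V" "norm v \<le> 1"
    using z(1) by (auto simp: uv)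
  have max: "\<bar>x \<bullet> y\<bar> \<le> \<bar>u \<bullet> v\<bar>" if "x \<in> ?U" "y \<in> ?V" "norm x \<le> 1" "norm y \<le> 1" for x y
    using z(2)[of "(x, y)"] that by (auto simp: uv)
  have val: "friedrichs_linear U V = \<bar>u \<bullet> v\<bar>"
    unfolding friedrichs_linear_def
  proof (rule cSup_eq_maximum)
    show "\<bar>u \<bullet> v\<bar> \<in> {\<bar>u \<bullet> v\<bar> | u v. u \<in> ?U \<and> v \<in> ?V \<and> norm u \<le> 1 \<and> norm v \<le> 1}"
      using u v by blast
  next
    fix t assume "t \<in> {\<bar>u \<bullet> v\<bar> | u v. u \<in> ?U \<and> v \<in> ?V \<and> norm u \<le> 1 \<and> norm v \<le> 1}"
    then show "t \<le> \<bar>u \<bullet> v\<bar>"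
      using max by blast
  qed
  let ?s = "if 0 \<le> u \<bullet> v then u else - u"
  show thesis
  proof (rule that)
    show "?s \<in> ?U"
      using u(1) subspace_neg[OF sub(1), of u] by simp
    show "norm ?s \<le> 1" "?s \<bullet> v = friedrichs_linear U V"
      using u(2) by (auto simp: val)
  qed (use v max val in auto)
qed

lemma friedrichs_linear_nonneg:
  assumes "subspace U" "subspace V"
  shows "0 \<le> friedrichs_linear U V"
proof (rule friedrichs_linear_attained[OF assms])
  fix u v assume "u \<in> U \<inter> (U \<inter> V)\<^sup>\<bottom>" "v \<in> V \<inter> (U \<inter> V)\<^sup>\<bottom>" "norm u \<le> 1" "norm v \<le> 1"
    and "\<And>x y. x \<in> U \<inter> (U \<inter> V)\<^sup>\<bottom> \<Longrightarrow> y \<in> V \<inter> (U \<inter> V)\<^sup>\<bottom> \<Longrightarrow> norm x \<le> 1 \<Longrightarrow> norm y \<le> 1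
      \<Longrightarrow> \<bar>x \<bullet> y\<bar> \<le> friedrichs_linear U V"
  then show ?thesis
    using abs_ge_zero order_trans by blast
qed

text \<open>By compactness the supremum is attained; if it were 1, the equality case of Cauchy--Schwarz
  would give a unit vector of \<open>U \<inter> V\<close> orthogonal to \<open>U \<inter> V\<close>.\<close>

lemma friedrichs_linear_less_1:
  assumes "subspace U" "subspace V"
  shows "friedrichs_linear U V < 1"
proof (rule friedrichs_linear_attained[OF assms])
  fix u v
  assume u: "u \<in> U \<inter> (U \<inter> V)\<^sup>\<bottom>" "norm u \<le> 1" and v: "v \<in> V \<inter> (U \<inter> V)\<^sup>\<bottom>" "norm v \<le> 1"
    and uv: "u \<bullet> v = friedrichs_linear U V"
  show ?thesis
  proof (rule ccontr)
    assume "\<not> ?thesis"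
    then have ge: "1 \<le> u \<bullet> v"
      using uv by simp
    have "u \<bullet> u \<le> 1" "v \<bullet> v \<le> 1"
      using u(2) v(2) by (simp_all add: dot_square_norm power_le_one)
    then have "(norm (u - v))\<^sup>2 \<le> 0"
      using ge by (simp add: power2_norm_eq_inner inner_diff inner_commute)
    then have "u = v" by simp
    then have "u \<bullet> u = 0"
      using u(1) v(1) by (auto simp: orthogonal_comp_iff)
    then show False
      using ge \<open>u = v\<close> by simp
  qed
qed

lemma friedrichs_linear_bound:
  assumes "subspace U" "subspace V" and x: "x \<in> U \<inter> (U \<inter> V)\<^sup>\<bottom>" and y: "y \<in> V \<inter> (U \<inter> V)\<^sup>\<bottom>"
  shows "\<bar>x \<bullet> y\<bar> \<le> friedrichs_linear U V * norm x * norm y"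
proof (cases "x = 0 \<or> y = 0")
  case False
  have sub: "subspace (U \<inter> (U \<inter> V)\<^sup>\<bottom>)" "subspace (V \<inter> (U \<inter> V)\<^sup>\<bottom>)"
    using assms by (simp_all add: subspace_inter subspace_orthogonal_comp)
  have "x /\<^sub>R norm x \<in> U \<inter> (U \<inter> V)\<^sup>\<bottom>" "y /\<^sub>R norm y \<in> V \<inter> (U \<inter> V)\<^sup>\<bottom>"
    using subspace_scale[OF sub(1) x] subspace_scale[OF sub(2) y] by blast+
  moreover have "norm (x /\<^sub>R norm x) \<le> 1" "norm (y /\<^sub>R norm y) \<le> 1"
    using False by simp_all
  ultimately have "\<bar>(x /\<^sub>R norm x) \<bullet> (y /\<^sub>R norm y)\<bar> \<le> friedrichs_linear U V"
    using friedrichs_linear_attained[OF assms(1,2)] by blast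
  then show ?thesis
    using False by (simp add: abs_mult field_simps)
qed auto

section \<open>Angles between normal directions\<close>

text \<open>Removing from \<open>v\<close> and \<open>u\<close> their common component in \<open>U \<inter> V\<close> leaves the difference \<open>w = v - u\<close> unchanged
  and makes the Friedrichs bound available. It gives \<open>norm u' \<le> \<kappa> * norm v'\<close>, hence
  \<open>(norm w)\<^sup>2 \<ge> (1 - \<kappa>\<^sup>2) * (norm v')\<^sup>2\<close>. Since \<open>w \<bullet> v' = (norm w)\<^sup>2\<close>, the projection \<open>t = w - z\<close> of \<open>w\<close> onto
  \<open>V\<close> has at least \<open>norm w * sqrt (1 - \<kappa>\<^sup>2)\<close> as its norm, and Pythagoras bounds what is left.\<close>

lemma orthogonal_residual_contracts:
  fixes U V :: "'a::euclidean_space set"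
  assumes U: "subspace U" and V: "subspace V"
    and u: "u \<in> U" and v: "v \<in> V" and w: "v - u \<in> U\<^sup>\<bottom>"
    and z: "z \<in> V\<^sup>\<bottom>" and wz: "(v - u) - z \<in> V"
  shows "norm z \<le> friedrichs_linear U V * norm (v - u)"
proof -
  define \<kappa> where "\<kappa> = friedrichs_linear U V"
  have \<kappa>: "0 \<le> \<kappa>" "\<kappa> < 1"
    using friedrichs_linear_nonneg[OF U V] friedrichs_linear_less_1[OF U V] by (simp_all add: \<kappa>_def)
  obtain e v' where e: "e \<in> U \<inter> V" and v': "\<And>x. x \<in> U \<inter> V \<Longrightarrow> orthogonal v' x" and eq: "v = e + v'"
    using orthogonal_subspace_decomp_exists[of "U \<inter> V" v] subspace_inter[OF U V]
    by (metis span_eq_iff)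
  define u' w where "u' = u - e" and "w = v - u"
  have w_eq: "w = v' - u'"
    by (simp add: u'_def w_def eq)
  have u'U: "u' \<in> U" and v'V: "v' \<in> V"
    using e u v subspace_diff[OF U, of u e] subspace_diff[OF V, of v e] by (auto simp: u'_def eq)
  have w_orth: "w \<bullet> x = 0" if "x \<in> U" for x
    using w that by (simp add: orthogonal_comp_iff w_def inner_commute)
  have z_orth: "z \<bullet> x = 0" if "x \<in> V" for x
    using z that by (simp add: orthogonal_comp_iff inner_commute)
  have v'0: "v' \<in> V \<inter> (U \<inter> V)\<^sup>\<bottom>"
    using v' v'V by (auto simp: orthogonal_comp_iff orthogonal_def inner_commute)
  have "u' \<bullet> x = 0" if "x \<in> U \<inter> V" for x
    using w_orth[of x] v'[OF that] that by (simp add: w_eq orthogonal_def inner_diff_left)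
  then have u'0: "u' \<in> U \<inter> (U \<inter> V)\<^sup>\<bottom>"
    using u'U by (auto simp: orthogonal_comp_iff inner_commute)
  have uv: "u' \<bullet> v' = (norm u')\<^sup>2"
    using w_orth[OF u'U] by (simp add: w_eq inner_diff inner_commute power2_norm_eq_inner)
  have "(norm u')\<^sup>2 \<le> \<kappa> * norm u' * norm v'"
    using friedrichs_linear_bound[OF U V u'0 v'0] uv by (simp add: \<kappa>_def)
  then have "norm u' \<le> \<kappa> * norm v'"
    using \<kappa>(1) by (cases "u' = 0") (auto simp: power2_eq_square field_simps)
  then have "(norm u')\<^sup>2 \<le> \<kappa>\<^sup>2 * (norm v')\<^sup>2"
    by (metis norm_ge_zero power_mono power_mult_distrib)
  moreover have w2: "(norm w)\<^sup>2 = (norm v')\<^sup>2 - (norm u')\<^sup>2"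
    using uv by (simp add: w_eq power2_norm_eq_inner inner_diff inner_commute)
  ultimately have lower: "(1 - \<kappa>\<^sup>2) * (norm v')\<^sup>2 \<le> (norm w)\<^sup>2"
    by (simp add: algebra_simps)
  define t where "t = w - z"
  have "t \<in> V"
    using wz by (simp add: t_def w_def)
  have pyth: "(norm w)\<^sup>2 = (norm t)\<^sup>2 + (norm z)\<^sup>2"
    using z_orth[OF \<open>t \<in> V\<close>] by (simp add: t_def power2_norm_eq_inner inner_diff inner_commute)
  have "t \<bullet> v' = (norm w)\<^sup>2"
    using z_orth[OF v'V] w_orth[OF u'U] uv w2
    by (simp add: t_def w_eq inner_diff power2_norm_eq_inner inner_commute)
  then have "(norm w)\<^sup>2 \<le> norm t * norm v'"
    by (metis norm_cauchy_schwarz)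
  then have "((norm w)\<^sup>2)\<^sup>2 \<le> (norm t)\<^sup>2 * (norm v')\<^sup>2"
    by (metis power_mono power_mult_distrib zero_le_power2)
  then have "(1 - \<kappa>\<^sup>2) * ((norm w)\<^sup>2)\<^sup>2 \<le> (1 - \<kappa>\<^sup>2) * ((norm t)\<^sup>2 * (norm v')\<^sup>2)"
    using \<kappa> by (intro mult_left_mono) (auto simp: power_le_one)
  also have "\<dots> \<le> (norm t)\<^sup>2 * (norm w)\<^sup>2"
    using mult_left_mono[OF lower, of "(norm t)\<^sup>2"] by (simp add: algebra_simps)
  finally have "(1 - \<kappa>\<^sup>2) * (norm w)\<^sup>2 * (norm w)\<^sup>2 \<le> (norm t)\<^sup>2 * (norm w)\<^sup>2"
    by (simp add: power2_eq_square mult.assoc)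
  then have "(1 - \<kappa>\<^sup>2) * (norm w)\<^sup>2 \<le> (norm t)\<^sup>2"
    by (cases "w = 0") simp_all
  then have "(norm z)\<^sup>2 \<le> (\<kappa> * norm w)\<^sup>2"
    using pyth unfolding power_mult_distrib left_diff_distrib by linarith
  then have "norm z \<le> \<kappa> * norm w"
    by (rule power2_le_imp_le) (simp add: \<kappa>(1))
  then show ?thesis
    by (simp add: \<kappa>_def w_def)
qed

text \<open>The orthogonal complement of \<open>U\<close> relative to \<open>U + V\<close>. It turns out to be the restricted normal cone of
  an affine set with direction \<open>U\<close> with respect to an affine set with direction \<open>V\<close>
  (\<open>normal_cone_affine\<close>).\<close>

definition normal_directions :: "'a::euclidean_space set \<Rightarrow> 'a set \<Rightarrow> 'a set" where
  "normal_directions U V = U\<^sup>\<bottom> \<inter> span (U \<union> V)"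

lemma subspace_normal_directions: "subspace (normal_directions U V)"
  by (simp add: normal_directions_def subspace_inter subspace_orthogonal_comp)

lemma normal_directions_iff:
  assumes "subspace U" "subspace V"
  shows "w \<in> normal_directions U V \<longleftrightarrow> w \<in> U\<^sup>\<bottom> \<and> (\<exists>u\<in>U. \<exists>v\<in>V. w = v - u)"
proof -
  have "w \<in> span (U \<union> V) \<longleftrightarrow> (\<exists>u\<in>U. \<exists>v\<in>V. w = u + v)"
    using assms by (auto simp: span_Un span_eq_iff[THEN iffD2])
  also have "\<dots> \<longleftrightarrow> (\<exists>u\<in>U. \<exists>v\<in>V. w = v - u)"
    by (metis (no_types, opaque_lifting) add.commute assms(1) diff_conv_add_uminus minus_minus subspace_neg)
  finally show ?thesis
    by (simp add: normal_directions_def)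
qed

text \<open>Only the component of \<open>w\<close> orthogonal to \<open>V\<close> is seen by \<open>z\<close>, and that component is contracted by the
  factor \<open>\<kappa>\<close>.\<close>

lemma inner_normal_directions_le:
  assumes U: "subspace U" and V: "subspace V"
    and w: "w \<in> normal_directions U V" "norm w \<le> 1" and z: "z \<in> normal_directions V U" "norm z \<le> 1"
  shows "w \<bullet> z \<le> friedrichs_linear U V"
proof -
  obtain t r where t: "t \<in> V" and r: "\<And>x. x \<in> V \<Longrightarrow> orthogonal r x" and eq: "w = t + r"
    using orthogonal_subspace_decomp_exists[of V w] V by (metis span_eq_iff)
  obtain u v where uv: "u \<in> U" "v \<in> V" "w = v - u" and wU: "w \<in> U\<^sup>\<bottom>"
    using w(1) normal_directions_iff[OF U V] by blast
  have "r \<in> V\<^sup>\<bottom>"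
    using r by (simp add: orthogonal_comp_iff orthogonal_def inner_commute)
  then have "norm r \<le> friedrichs_linear U V * norm w"
    using orthogonal_residual_contracts[OF U V uv(1,2), of r] wU t eq by (simp add: uv(3)[symmetric])
  also have "\<dots> \<le> friedrichs_linear U V"
    using friedrichs_linear_nonneg[OF U V] w(2) by (simp add: mult_left_le)
  finally have "norm r * norm z \<le> friedrichs_linear U V"
    using z(2) by (meson mult_left_le norm_ge_zero order_trans)
  moreover have "w \<bullet> z = r \<bullet> z"
    using z(1) t by (simp add: eq normal_directions_def orthogonal_comp_iff inner_add_left)
  ultimately show ?thesis
    using norm_cauchy_schwarz[of r z] by linarith
qed

text \<open>The first-order optimality condition of the Friedrichs supremum: the projection of \<open>v\<close> onto \<open>U\<close> has norm at
  most \<open>\<kappa>\<close>, while its inner product with \<open>u\<close> is \<open>\<kappa>\<close>, so it must be \<open>\<kappa> u\<close>.\<close>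

lemma friedrichs_maximizer_residual:
  assumes U: "subspace U" and V: "subspace V"
    and u: "u \<in> U \<inter> (U \<inter> V)\<^sup>\<bottom>" "norm u \<le> 1" and v: "v \<in> V \<inter> (U \<inter> V)\<^sup>\<bottom>" "norm v \<le> 1"
    and uv: "u \<bullet> v = friedrichs_linear U V"
  shows "v - friedrichs_linear U V *\<^sub>R u \<in> U\<^sup>\<bottom>"
proof -
  define \<kappa> where "\<kappa> = friedrichs_linear U V"
  have \<kappa>: "0 \<le> \<kappa>"
    using friedrichs_linear_nonneg[OF U V] by (simp add: \<kappa>_def)
  obtain t r where t: "t \<in> U" and r: "\<And>x. x \<in> U \<Longrightarrow> orthogonal r x" and eq: "v = t + r"
    using orthogonal_subspace_decomp_exists[of U v] U by (metis span_eq_iff)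
  have r0: "r \<bullet> x = 0" if "x \<in> U" for x
    using r[OF that] by (simp add: orthogonal_def)
  have "x \<bullet> t = 0" if "x \<in> U \<inter> V" for x
  proof -
    have "x \<bullet> (t + r) = 0"
      using v(1) that by (simp add: orthogonal_comp_iff flip: eq)
    then show ?thesis
      using r0[of x] that by (simp add: inner_add_right inner_commute)
  qed
  then have t0: "t \<in> U \<inter> (U \<inter> V)\<^sup>\<bottom>"
    using t by (simp add: orthogonal_comp_iff)
  have "(norm t)\<^sup>2 = t \<bullet> v"
    using r0[OF t] by (simp add: eq inner_add_right power2_norm_eq_inner inner_commute)
  also have "\<dots> \<le> \<kappa> * norm t * norm v"
    using friedrichs_linear_bound[OF U V t0 v(1)] by (simp add: \<kappa>_def)
  also have "\<dots> \<le> \<kappa> * norm t"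
    using v(2) \<kappa> by (simp add: mult_left_le)
  finally have "norm t \<le> \<kappa>"
    using \<kappa> by (cases "t = 0") (auto simp: power2_eq_square)
  then have t2: "(norm t)\<^sup>2 \<le> \<kappa>\<^sup>2"
    by (simp add: power_mono)
  have tu: "t \<bullet> u = \<kappa>"
    using uv r0[of u] u(1) by (simp add: eq \<kappa>_def inner_add_right inner_commute)
  have "(norm u)\<^sup>2 \<le> 1"
    using u(2) by (simp add: power_le_one)
  then have "\<kappa>\<^sup>2 * (norm u)\<^sup>2 \<le> \<kappa>\<^sup>2"
    by (simp add: mult_left_le)
  moreover have "(norm (t - \<kappa> *\<^sub>R u))\<^sup>2 = (norm t)\<^sup>2 - 2 * \<kappa> * (t \<bullet> u) + \<kappa>\<^sup>2 * (norm u)\<^sup>2"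
    unfolding power2_norm_eq_inner
    by (simp add: inner_diff inner_commute algebra_simps power2_eq_square)
  ultimately have "(norm (t - \<kappa> *\<^sub>R u))\<^sup>2 \<le> 0"
    using t2 tu by (simp add: power2_eq_square)
  then have "t = \<kappa> *\<^sub>R u" by simp
  then show ?thesis
    using r0 by (simp add: orthogonal_comp_iff eq \<kappa>_def inner_commute)
qed

text \<open>For \<open>\<kappa> = 0\<close> zero vectors serve. Otherwise the residuals of an optimal pair are orthogonal to \<open>U\<close> and to \<open>V\<close>, have equal norms \<open>sqrt (1 - \<kappa>\<^sup>2)\<close>, and
  form the angle with cosine \<open>\<kappa>\<close>. With the preceding bound this says that \<open>U\<^sup>\<bottom>\<close> and \<open>V\<^sup>\<bottom>\<close>, relative to \<open>U + V\<close>,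
  have the same angle as \<open>U\<close> and \<open>V\<close>.\<close>

lemma inner_normal_directions_attained:
  assumes U: "subspace U" and V: "subspace V"
  obtains w z where "w \<in> normal_directions U V" "norm w \<le> 1" "z \<in> normal_directions V U" "norm z \<le> 1"
    "w \<bullet> z = friedrichs_linear U V"
proof -
  define \<kappa> where "\<kappa> = friedrichs_linear U V"
  have \<kappa>: "0 \<le> \<kappa>" "\<kappa> < 1"
    using friedrichs_linear_nonneg[OF U V] friedrichs_linear_less_1[OF U V] by (simp_all add: \<kappa>_def)
  obtain u v where u: "u \<in> U \<inter> (U \<inter> V)\<^sup>\<bottom>" "norm u \<le> 1" and v: "v \<in> V \<inter> (U \<inter> V)\<^sup>\<bottom>" "norm v \<le> 1"
    and uv: "u \<bullet> v = \<kappa>"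
    using friedrichs_linear_attained[OF U V] unfolding \<kappa>_def by metis
  show thesis
  proof (cases "\<kappa> = 0")
    case True
    then show thesis
      using that[of 0 0] subspace_0[OF subspace_normal_directions, of U V]
        subspace_0[OF subspace_normal_directions, of V U] by (simp add: \<kappa>_def)
  next
    case False
    define w z where "w = v - \<kappa> *\<^sub>R u" and "z = \<kappa> *\<^sub>R v - u"
    define \<mu> where "\<mu> = 1 - \<kappa>\<^sup>2"
    have "\<mu> > 0"
      using \<kappa> by (simp add: \<mu>_def power_less_one_iff abs_square_less_1)
    have wU: "w \<in> U\<^sup>\<bottom>"
      using friedrichs_maximizer_residual[OF U V u v] uv by (simp add: w_def \<kappa>_def)
    have "u - \<kappa> *\<^sub>R v \<in> V\<^sup>\<bottom>"
      using friedrichs_maximizer_residual[OF V U, of v u] u v uv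
      by (simp add: \<kappa>_def friedrichs_linear_commute[of V U] Int_commute inner_commute)
    then have zV: "z \<in> V\<^sup>\<bottom>"
      using subspace_neg[OF subspace_orthogonal_comp, of "u - \<kappa> *\<^sub>R v" V] by (simp add: z_def)
    have w: "w \<in> normal_directions U V"
      using wU v(1) subspace_scale[OF U, of u \<kappa>] u(1)
      by (auto simp: normal_directions_iff[OF U V] w_def)
    have "z = - u - - (\<kappa> *\<^sub>R v)"
      by (simp add: z_def)
    then have z: "z \<in> normal_directions V U"
      using zV u(1) v(1) subspace_scale[OF V, of v \<kappa>] subspace_neg[OF U] subspace_neg[OF V]
      unfolding normal_directions_iff[OF V U] by blast
    have uw: "u \<bullet> w = 0" and vz: "v \<bullet> z = 0"
      using wU zV u(1) v(1) by (auto simp: orthogonal_comp_iff)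
    \<comment> \<open>The optimal vectors are unit vectors: \<open>0 = u \<bullet> w = \<kappa> - \<kappa> (u \<bullet> u)\<close>, and likewise for \<open>v\<close>.\<close>
    have uu: "u \<bullet> u = 1" and vv: "v \<bullet> v = 1"
      using uw vz uv False by (simp_all add: w_def z_def inner_diff inner_commute)
    have "w \<bullet> w = \<mu>" "z \<bullet> z = \<mu>" and wz: "w \<bullet> z = \<kappa> * \<mu>"
      by (simp_all add: w_def z_def \<mu>_def inner_diff inner_commute uu vv uv power2_eq_square algebra_simps)
    then have nw: "norm w = sqrt \<mu>" "norm z = sqrt \<mu>"
      by (simp_all add: norm_eq_sqrt_inner)
    show thesis
    proof (rule that)
      show "w /\<^sub>R sqrt \<mu> \<in> normal_directions U V" "z /\<^sub>R sqrt \<mu> \<in> normal_directions V U"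
        using w z by (auto intro: subspace_scale subspace_normal_directions)
      show "norm (w /\<^sub>R sqrt \<mu>) \<le> 1" "norm (z /\<^sub>R sqrt \<mu>) \<le> 1"
        using \<open>\<mu> > 0\<close> by (simp_all add: nw)
      show "(w /\<^sub>R sqrt \<mu>) \<bullet> (z /\<^sub>R sqrt \<mu>) = friedrichs_linear U V"
        using \<open>\<mu> > 0\<close> by (simp add: wz \<kappa>_def field_simps)
    qed
  qed
qed

section \<open>Projections onto affine sets\<close>

lemma parallel_subspace_affine:
  assumes "affine C" "c \<in> C"
  shows subspace_parallel_subspace: "subspace (parallel_subspace C)"
    and diff_in_parallel_subspace_iff: "x - c \<in> parallel_subspace C \<longleftrightarrow> x \<in> C"
proof -
  have "subspace (parallel_subspace C) \<and> affine_parallel C (parallel_subspace C)"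
    unfolding parallel_subspace_def using assms(2)
    by (intro theI'[OF affine_parallel_subspace[OF assms(1)]]) blast
  then have sub: "subspace (parallel_subspace C)" and par: "affine_parallel C (parallel_subspace C)"
    by auto
  then obtain t where t: "parallel_subspace C = (+) t ` C"
    by (auto simp: affine_parallel_def)
  show "subspace (parallel_subspace C)"
    by (rule sub)
  have tc: "t + c \<in> parallel_subspace C"
    using t assms(2) by blast
  have "x - c \<in> parallel_subspace C \<longleftrightarrow> x + t \<in> parallel_subspace C"
    using subspace_add[OF sub _ tc, of "x - c"] subspace_diff[OF sub _ tc, of "x + t"]
    by (metis add.commute add_diff_cancel_right add_diff_eq diff_add_cancel)
  also have "\<dots> \<longleftrightarrow> x \<in> C"
    by (metis add.commute add_left_imp_eq image_iff t)
  finally show "x - c \<in> parallel_subspace C \<longleftrightarrow> x \<in> C" .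
qed

lemma diff_in_parallel_subspace:
  assumes "affine C" "x \<in> C" "y \<in> C"
  shows "x - y \<in> parallel_subspace C"
  using diff_in_parallel_subspace_iff assms by blast

lemma proj_iff_dist: "a \<in> proj S x \<longleftrightarrow> a \<in> S \<and> (\<forall>y\<in>S. dist x a \<le> dist x y)"
proof -
  have "norm (x - a) = infdist x S \<longleftrightarrow> (\<forall>y\<in>S. dist x a \<le> dist x y)" if "a \<in> S"
  proof
    assume "\<forall>y\<in>S. dist x a \<le> dist x y"
    then have "dist x a \<le> infdist x S"
      using that by (subst infdist_notempty) (auto intro!: cINF_greatest)
    then show "norm (x - a) = infdist x S"
      using infdist_le[OF that, of x] by (simp add: dist_norm)
  next
    assume "norm (x - a) = infdist x S"
    then show "\<forall>y\<in>S. dist x a \<le> dist x y"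
      using infdist_le by (metis dist_norm)
  qed
  then show ?thesis
    by (auto simp: proj_def)
qed

lemma proj_affine_iff:
  assumes "affine C"
  shows "a \<in> proj C x \<longleftrightarrow> a \<in> C \<and> x - a \<in> (parallel_subspace C)\<^sup>\<bottom>"
proof (cases "a \<in> C")
  case a: True
  let ?U = "parallel_subspace C"
  have sub: "subspace ?U"
    using subspace_parallel_subspace[OF assms a] .
  have "(\<forall>y\<in>C. dist x a \<le> dist x y) \<longleftrightarrow> x - a \<in> ?U\<^sup>\<bottom>"
  proof
    assume min: "\<forall>y\<in>C. dist x a \<le> dist x y"
    have le: "(x - a) \<bullet> u \<le> 0" if "u \<in> ?U" for u
    proof -
      have "a + u \<in> C"
        using that diff_in_parallel_subspace_iff[OF assms a, of "a + u"] by simp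
      then show ?thesis
        using any_closest_point_dot[of C a "a + u" x] min a affine_imp_convex[OF assms]
          affine_closed[OF assms] by simp
    qed
    have "(x - a) \<bullet> u = 0" if "u \<in> ?U" for u
      using le[OF that] le[OF subspace_neg[OF sub that]] by simp
    then show "x - a \<in> ?U\<^sup>\<bottom>"
      by (simp add: orthogonal_comp_iff inner_commute)
  next
    assume orth: "x - a \<in> ?U\<^sup>\<bottom>"
    show "\<forall>y\<in>C. dist x a \<le> dist x y"
    proof
      fix y assume "y \<in> C"
      then have "(a - y) \<bullet> (x - a) = 0"
        using orth diff_in_parallel_subspace[OF assms a] by (auto simp: orthogonal_comp_iff)
      then have "(norm (x - y))\<^sup>2 = (norm (x - a))\<^sup>2 + (norm (a - y))\<^sup>2"
        by (simp add: power2_norm_eq_inner inner_diff inner_commute algebra_simps)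
      then have "(norm (x - a))\<^sup>2 \<le> (norm (x - y))\<^sup>2"
        by simp
      then show "dist x a \<le> dist x y"
        by (simp add: dist_norm)
    qed
  qed
  then show ?thesis
    using a by (simp add: proj_iff_dist)
qed (simp add: proj_def)

lemma proj_affine_norm_le:
  assumes "affine C" "c \<in> C" "a \<in> proj C x"
  shows "norm (a - c) \<le> norm (x - c)"
proof -
  have a: "a \<in> C" "x - a \<in> (parallel_subspace C)\<^sup>\<bottom>"
    using assms by (simp_all add: proj_affine_iff)
  then have "(a - c) \<bullet> (x - a) = 0"
    using diff_in_parallel_subspace[OF assms(1) a(1) assms(2)] by (simp add: orthogonal_comp_iff)
  then have "(norm (x - c))\<^sup>2 = (norm (x - a))\<^sup>2 + (norm (a - c))\<^sup>2"
    by (simp add: power2_norm_eq_inner inner_diff inner_commute algebra_simps)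
  then have "(norm (a - c))\<^sup>2 \<le> (norm (x - c))\<^sup>2"
    by simp
  then show ?thesis
    by simp
qed

text \<open>If \<open>b\<close> lies in \<open>D\<close>, then the displacement \<open>b - a\<close> is a normal direction of \<open>C\<close>, and \<open>a - b'\<close> is, up to sign, its
  component orthogonal to \<open>D\<close>.\<close>

lemma alternating_step_contracts:
  assumes C: "affine C" "c \<in> C" and D: "affine D" "c \<in> D"
    and b: "b \<in> D" and a: "a \<in> proj C b" and b': "b' \<in> proj D a"
  shows "dist a b' \<le> friedrichs C D * dist b a"
proof -
  have a': "a \<in> C" "b - a \<in> (parallel_subspace C)\<^sup>\<bottom>" and b'': "b' \<in> D" "a - b' \<in> (parallel_subspace D)\<^sup>\<bottom>"
    using a b' C D by (simp_all add: proj_affine_iff)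
  have "b' - a \<in> (parallel_subspace D)\<^sup>\<bottom>"
    using subspace_neg[OF subspace_orthogonal_comp b''(2)] by simp
  then have "norm (b' - a) \<le> friedrichs C D * norm ((b - c) - (a - c))"
    unfolding friedrichs_def
    using orthogonal_residual_contracts[OF subspace_parallel_subspace[OF C] subspace_parallel_subspace[OF D]
        diff_in_parallel_subspace[OF C(1) a'(1) C(2)] diff_in_parallel_subspace[OF D(1) b D(2)], of "b' - a"]
      a'(2) diff_in_parallel_subspace[OF D(1) b b''(1)] by simp
  then show ?thesis
    by (simp add: dist_norm norm_minus_commute)
qed

lemma friedrichs_commute: "friedrichs C D = friedrichs D C"
  by (simp add: friedrichs_def friedrichs_linear_commute)

lemma friedrichs_nonneg:
  assumes "affine C" "C \<noteq> {}" "affine D" "D \<noteq> {}"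
  shows "0 \<le> friedrichs C D"
  unfolding friedrichs_def
  using assms by (meson ex_in_conv friedrichs_linear_nonneg subspace_parallel_subspace)

lemma friedrichs_less_1:
  assumes "affine C" "C \<noteq> {}" "affine D" "D \<noteq> {}"
  shows "friedrichs C D < 1"
  unfolding friedrichs_def
  using assms by (meson ex_in_conv friedrichs_linear_less_1 subspace_parallel_subspace)

section \<open>Restricted normal cones and CQ-numbers of affine sets\<close>

lemma prox_normal_cone_affine_subset:
  assumes C: "affine C" "c \<in> C" and D: "affine D" "c \<in> D"
  shows "prox_normal_cone C D a \<subseteq> normal_directions (parallel_subspace C) (parallel_subspace D)"
    (is "_ \<subseteq> ?N")
proof (cases "a \<in> C")
  case True
  have "x - a \<in> ?N" if "x \<in> D" "a \<in> proj C x" for x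
  proof -
    have a: "a \<in> C" "x - a \<in> (parallel_subspace C)\<^sup>\<bottom>"
      using that C by (simp_all add: proj_affine_iff)
    moreover have "x - a = (x - c) - (a - c)"
      by simp
    ultimately show ?thesis
      unfolding normal_directions_iff[OF subspace_parallel_subspace[OF C] subspace_parallel_subspace[OF D]]
      using diff_in_parallel_subspace[OF C(1) a(1) C(2)] diff_in_parallel_subspace[OF D(1) that(1) D(2)]
      by blast
  qed
  then show ?thesis
    using True subspace_0[OF subspace_normal_directions, of "parallel_subspace C" "parallel_subspace D"]
    by (auto simp: prox_normal_cone_def cone_of_def proj_inv_def
        intro!: subspace_scale[OF subspace_normal_directions])
qed (simp add: prox_normal_cone_def)

text \<open>Writing \<open>w = v - u\<close>, the point \<open>c + t u\<close> of \<open>C\<close> is the projection of the point \<open>c + t v\<close> of \<open>D\<close>, for every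
  \<open>t\<close>, and the displacement is \<open>t w\<close>. So \<open>w\<close> is a normal along a whole ray that ends at \<open>c\<close>.\<close>

lemma normal_direction_in_prox_normal_cone:
  assumes C: "affine C" "c \<in> C" and D: "affine D" "c \<in> D"
    and w: "w \<in> normal_directions (parallel_subspace C) (parallel_subspace D)"
  obtains d where "\<And>t. 0 < t \<Longrightarrow> w \<in> prox_normal_cone C D (c + t *\<^sub>R d)"
proof -
  have sub: "subspace (parallel_subspace C)" "subspace (parallel_subspace D)"
    using subspace_parallel_subspace C D by blast+
  obtain u v where uv: "u \<in> parallel_subspace C" "v \<in> parallel_subspace D" "w = v - u"
    and orth: "w \<in> (parallel_subspace C)\<^sup>\<bottom>"
    using w normal_directions_iff[OF sub] by blast
  show thesis
  proof (rule that)
    fix t :: real assume t: "0 < t"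
    let ?x = "c + t *\<^sub>R v" and ?a = "c + t *\<^sub>R u"
    have a: "?a \<in> C" and x: "?x \<in> D"
      using uv subspace_scale[OF sub(1), of u t] subspace_scale[OF sub(2), of v t]
        diff_in_parallel_subspace_iff[OF C, of ?a] diff_in_parallel_subspace_iff[OF D, of ?x] by simp_all
    have diff: "?x - ?a = t *\<^sub>R w"
      by (simp add: uv algebra_simps)
    then have "?a \<in> proj C ?x"
      using a subspace_scale[OF subspace_orthogonal_comp orth, of t] by (simp add: proj_affine_iff[OF C(1)])
    then have mem: "?x - ?a \<in> (\<lambda>x. x - ?a) ` (D \<inter> proj_inv C ?a)"
      using x unfolding proj_inv_def by blast
    moreover have "w = (1 / t) *\<^sub>R (?x - ?a)"
      unfolding diff using t by simp
    ultimately have "w \<in> cone_of ((\<lambda>x. x - ?a) ` (D \<inter> proj_inv C ?a))"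
      unfolding cone_of_def using t by (smt (verit) empty_iff mem_Collect_eq zero_le_divide_1_iff)
    then show "w \<in> prox_normal_cone C D ?a"
      using a by (simp add: prox_normal_cone_def)
  qed
qed

lemma normal_cone_affine:
  assumes C: "affine C" "c \<in> C" and D: "affine D" "c \<in> D"
  shows "normal_cone C D c = normal_directions (parallel_subspace C) (parallel_subspace D)" (is "_ = ?N")
proof
  have "closed ?N"
    by (intro closed_subspace subspace_normal_directions)
  then show "normal_cone C D c \<subseteq> ?N"
    using prox_normal_cone_affine_subset[OF C D] C
    by (auto simp: normal_cone_def closed_sequential_limits subset_iff) blast
  show "?N \<subseteq> normal_cone C D c"
  proof
    fix w assume "w \<in> ?N"
    from normal_direction_in_prox_normal_cone[OF C D this]
    obtain d where d: "\<And>t. 0 < t \<Longrightarrow> w \<in> prox_normal_cone C D (c + t *\<^sub>R d)"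
      by blast
    let ?a = "\<lambda>k. c + (1 / real (Suc k)) *\<^sub>R d"
    have cone: "w \<in> prox_normal_cone C D (?a k)" for k
      by (rule d) simp
    then have "?a k \<in> C" for k
      by (metis empty_iff prox_normal_cone_def)
    moreover have "?a \<longlonglongrightarrow> c + 0 *\<^sub>R d"
      by (intro tendsto_intros LIMSEQ_Suc lim_const_over_n)
    ultimately show "w \<in> normal_cone C D c"
      using cone C unfolding normal_cone_def
      by (simp del: of_nat_Suc, intro exI[of _ ?a] exI[of _ "\<lambda>_. w"]) simp
  qed
qed

lemma exact_CQ_number_affine:
  assumes C: "affine C" "c \<in> C" and D: "affine D" "c \<in> D"
  shows "exact_CQ_number c C C D D = ereal (friedrichs C D)"
proof -
  let ?U = "parallel_subspace C" and ?V = "parallel_subspace D"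
  have sub: "subspace ?U" "subspace ?V"
    using subspace_parallel_subspace C D by blast+
  have neg: "uminus ` normal_directions ?V ?U = normal_directions ?V ?U"
    using subspace_neg[OF subspace_normal_directions, of _ ?V ?U] by (force simp: image_iff)
  show ?thesis
    unfolding exact_CQ_number_def normal_cone_affine[OF C D] normal_cone_affine[OF D C] neg friedrichs_def
  proof (rule Sup_eqI)
    fix y assume ub: "\<And>z. z \<in> {ereal (u \<bullet> v) | u v. u \<in> normal_directions ?U ?V
      \<and> v \<in> normal_directions ?V ?U \<and> norm u \<le> 1 \<and> norm v \<le> 1} \<Longrightarrow> z \<le> y"
    show "ereal (friedrichs_linear ?U ?V) \<le> y"
      by (rule inner_normal_directions_attained[OF sub], rule ub) (simp, metis)
  qed (use inner_normal_directions_le[OF sub] in auto)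
qed

text \<open>All radii give the same value because every normal direction is a restricted proximal normal at points
  arbitrarily close to \<open>c\<close>.\<close>

lemma CQ_number_affine:
  assumes C: "affine C" "c \<in> C" and D: "affine D" "c \<in> D" and "0 < \<delta>"
  shows "CQ_number c \<delta> C C D D = ereal (friedrichs C D)"
proof -
  let ?U = "parallel_subspace C" and ?V = "parallel_subspace D"
  have sub: "subspace ?U" "subspace ?V"
    using subspace_parallel_subspace C D by blast+
  have near: "\<exists>a. w \<in> prox_normal_cone C D a \<and> norm (a - c) \<le> \<delta>"
    if C: "affine C" "c \<in> C" and D: "affine D" "c \<in> D"
      and w: "w \<in> normal_directions (parallel_subspace C) (parallel_subspace D)" for C D w
  proof -
    obtain d where d: "\<And>t. 0 < t \<Longrightarrow> w \<in> prox_normal_cone C D (c + t *\<^sub>R d)"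
      using normal_direction_in_prox_normal_cone[OF C D w] by blast
    let ?t = "\<delta> / (1 + norm d)"
    have pos: "0 < 1 + norm d"
      by (simp add: add_pos_nonneg)
    then have "0 < ?t" "norm (?t *\<^sub>R d) \<le> \<delta>"
      using \<open>0 < \<delta>\<close> by (simp_all add: field_simps)
    then show ?thesis
      using d[of ?t] by (intro exI[of _ "c + ?t *\<^sub>R d"]) simp
  qed
  show ?thesis
    unfolding CQ_number_def friedrichs_def
  proof (rule Sup_eqI)
    fix y assume "y \<in> {ereal (u \<bullet> v) | u v a b. u \<in> prox_normal_cone C D a
      \<and> v \<in> uminus ` prox_normal_cone D C b \<and> norm u \<le> 1 \<and> norm v \<le> 1
      \<and> norm (a - c) \<le> \<delta> \<and> norm (b - c) \<le> \<delta>}"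
    then obtain u v a b where *: "y = ereal (u \<bullet> - v)" "u \<in> prox_normal_cone C D a"
      "v \<in> prox_normal_cone D C b" "norm u \<le> 1" "norm v \<le> 1"
      by auto
    then have "u \<in> normal_directions ?U ?V" "- v \<in> normal_directions ?V ?U"
      using prox_normal_cone_affine_subset[OF C D] prox_normal_cone_affine_subset[OF D C]
        subspace_neg[OF subspace_normal_directions] by blast+
    then show "y \<le> ereal (friedrichs_linear ?U ?V)"
      using inner_normal_directions_le[OF sub, of u "- v"] * by simp
  next
    fix y assume ub: "\<And>z. z \<in> {ereal (u \<bullet> v) | u v a b. u \<in> prox_normal_cone C D a
      \<and> v \<in> uminus ` prox_normal_cone D C b \<and> norm u \<le> 1 \<and> norm v \<le> 1
      \<and> norm (a - c) \<le> \<delta> \<and> norm (b - c) \<le> \<delta>} \<Longrightarrow> z \<le> y"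
    obtain w z where wz: "w \<in> normal_directions ?U ?V" "norm w \<le> 1" "z \<in> normal_directions ?V ?U"
      "norm z \<le> 1" "w \<bullet> z = friedrichs_linear ?U ?V"
      using inner_normal_directions_attained[OF sub] by metis
    obtain a where a: "w \<in> prox_normal_cone C D a" "norm (a - c) \<le> \<delta>"
      using near[OF C D wz(1)] by blast
    obtain b where b: "- z \<in> prox_normal_cone D C b" "norm (b - c) \<le> \<delta>"
      using near[OF D C subspace_neg[OF subspace_normal_directions wz(3)]] by blast
    have "z \<in> uminus ` prox_normal_cone D C b"
      using b(1) by (rule image_eqI[rotated]) simp
    then show "ereal (friedrichs_linear ?U ?V) \<le> y"
      using a b wz by (intro ub) (simp, metis)
  qed
qed

lemma CQ_number_eq_minus_infty:
  assumes "\<delta> < infdist c C"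
  shows "CQ_number c \<delta> C C' D D' = - \<infinity>"
proof -
  have "\<not> norm (a - c) \<le> \<delta>" if "u \<in> prox_normal_cone C D' a" for a u
  proof -
    have "a \<in> C"
      using that by (metis empty_iff prox_normal_cone_def)
    then show ?thesis
      using infdist_le[of a C c] assms by (simp add: dist_norm norm_minus_commute)
  qed
  then have "{ereal (u \<bullet> v) | u v a b. u \<in> prox_normal_cone C D' a
      \<and> v \<in> uminus ` prox_normal_cone D C' b \<and> norm u \<le> 1 \<and> norm v \<le> 1
      \<and> norm (a - c) \<le> \<delta> \<and> norm (b - c) \<le> \<delta>} = {}"
    by blast
  then show ?thesis
    unfolding CQ_number_def by (simp only: Sup_empty bot_ereal_def)
qed

lemma exact_CQ_number_eq_minus_infty:
  assumes "c \<notin> C"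
  shows "exact_CQ_number c C C' D D' = - \<infinity>"
  using assms by (simp add: exact_CQ_number_def normal_cone_def bot_ereal_def)

section \<open>Alternating projections between a union of affine sets and an affine set\<close>

text \<open>The sums are kept in the closed form \<open>K / (1 - q) * (q ^ k - q ^ (k + m))\<close>, which also covers \<open>q = 0\<close>:
  the sequence is then constant from index 1 on.\<close>

lemma geometric_steps_converge:
  fixes a :: "nat \<Rightarrow> 'a::complete_space"
  assumes q: "0 \<le> q" "q < 1" and step: "\<And>k. dist (a k) (a (Suc k)) \<le> K * q ^ k"
  obtains z where "a \<longlonglongrightarrow> z" "\<And>k. dist (a k) z \<le> K / (1 - q) * q ^ k"
proof -
  have K: "0 \<le> K"
    using order_trans[OF zero_le_dist step[of 0]] by simp
  have partial: "dist (a k) (a (k + m)) \<le> K / (1 - q) * (q ^ k - q ^ (k + m))" for k m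
  proof (induction m)
    case (Suc m)
    have "dist (a k) (a (k + Suc m)) \<le> dist (a k) (a (k + m)) + dist (a (k + m)) (a (Suc (k + m)))"
      by (simp add: dist_triangle)
    also have "\<dots> \<le> K / (1 - q) * (q ^ k - q ^ (k + m)) + K * q ^ (k + m)"
      using Suc step by (intro add_mono) auto
    also have "\<dots> = K / (1 - q) * (q ^ k - q ^ (k + Suc m))"
      using q by (simp add: field_simps)
    finally show ?case .
  qed simp
  have tail: "dist (a k) (a n) \<le> K / (1 - q) * q ^ k" if "k \<le> n" for k n
  proof -
    have "dist (a k) (a n) \<le> K / (1 - q) * (q ^ k - q ^ n)"
      using partial[of k "n - k"] that by simp
    also have "\<dots> \<le> K / (1 - q) * q ^ k"
      using K q by (intro mult_left_mono) auto
    finally show ?thesis .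
  qed
  have lim: "(\<lambda>k. K / (1 - q) * q ^ k) \<longlonglongrightarrow> 0"
    using q by (intro tendsto_mult_right_zero LIMSEQ_realpow_zero) auto
  have "Cauchy a"
    unfolding Cauchy_altdef2
  proof (intro allI impI)
    fix e :: real assume "0 < e"
    then obtain N where "K / (1 - q) * q ^ N < e"
      using order_tendstoD(2)[OF lim] by (auto simp: eventually_sequentially)
    then show "\<exists>N. \<forall>n\<ge>N. dist (a n) (a N) < e"
      using tail by (metis dist_commute le_less_trans)
  qed
  then obtain z where z: "a \<longlonglongrightarrow> z"
    using Cauchy_convergent convergent_def by blast
  have "dist (a k) z \<le> K / (1 - q) * q ^ k" for k
    by (rule tendsto_upperbound[OF tendsto_dist[OF tendsto_const z]])
      (rule eventually_mono[OF eventually_ge_at_top[of k] tail], simp_all)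
  with z show thesis
    by (rule that)
qed

text \<open>A point closer to \<open>c\<close> than \<open>r / 2\<close> has its nearest points in \<open>A\<close> at distance less than \<open>r\<close> from \<open>c\<close>, hence in
  pieces \<open>C j\<close> that contain \<open>c\<close>. Projections onto such pieces and onto \<open>B\<close> do not increase the distance to
  \<open>c\<close>, so all iterates remain in this neighbourhood, where the contraction for affine sets applies.\<close>

lemma MAP_union_affine_converges_linearly:
  fixes C :: "'i \<Rightarrow> 'a::euclidean_space set"
  assumes A: "A = (\<Union>j\<in>I. C j)" "closed A"
    and C: "\<And>j. j \<in> I \<Longrightarrow> affine (C j)" and B: "affine B" "c \<in> B" and "c \<in> A"
    and sep: "\<And>j. j \<in> I \<Longrightarrow> c \<notin> C j \<Longrightarrow> r \<le> infdist c (C j)"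
    and \<theta>: "0 \<le> \<theta>" "\<theta> < 1" "\<And>j. j \<in> I \<Longrightarrow> c \<in> C j \<Longrightarrow> friedrichs (C j) B \<le> \<theta>"
    and y: "2 * norm (y - c) < r"
    and MAP: "MAP_sequences A B y a b"
  shows "\<exists>z\<in>A \<inter> B. norm (z - c) \<le> norm (y - c) \<and> converge_linearly a b z (\<theta>\<^sup>2)"
proof -
  define x where "x k = (case k of 0 \<Rightarrow> y | Suc i \<Rightarrow> b i)" for k
  have a: "a k \<in> proj A (x k)" and b: "b k \<in> proj B (a k)" for k
    using MAP unfolding MAP_sequences_def x_def by blast+
  have bB: "b k \<in> B" for k
    using b[of k] by (simp add: proj_def)
  have branch: "\<exists>j\<in>I. c \<in> C j \<and> a' \<in> proj (C j) x'"
    if near: "2 * norm (x' - c) < r" and a': "a' \<in> proj A x'" for x' a'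
  proof -
    obtain j where j: "j \<in> I" "a' \<in> C j"
      using a' by (auto simp: proj_def A)
    have "dist c a' \<le> dist x' c + dist x' a'"
      by (metis dist_commute dist_triangle)
    also have "dist x' a' \<le> dist x' c"
      using a' \<open>c \<in> A\<close> by (simp add: proj_iff_dist)
    finally have "dist c a' < r"
      using near by (simp add: dist_norm)
    then have "c \<in> C j"
      using sep[OF j(1)] infdist_le[OF j(2), of c] by linarith
    moreover have "a' \<in> proj (C j) x'"
      using a' j by (auto simp: proj_iff_dist A)
    ultimately show ?thesis
      using j(1) by blast
  qed
  have b_le: "norm (b k - c) \<le> norm (a k - c)" for k
    by (rule proj_affine_norm_le[OF B b])
  have a_le: "norm (a k - c) \<le> norm (x k - c)" if "2 * norm (x k - c) < r" for k
    using branch[OF that a] C proj_affine_norm_le by blast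
  have bounded: "norm (x k - c) \<le> norm (y - c)" for k
  proof (induction k)
    case (Suc k)
    then have "norm (a k - c) \<le> norm (x k - c)"
      using a_le y by auto
    then show ?case
      using b_le[of k] Suc by (simp add: x_def)
  qed (simp add: x_def)
  then have near: "2 * norm (x k - c) < r" for k
    using y bounded[of k] by linarith
  \<comment> \<open>The contraction needs the point that is projected to lie in \<open>B\<close>; this can fail for \<open>y\<close>, so the
    estimates start with \<open>b 0\<close>.\<close>
  have half1: "dist (a (Suc k)) (b (Suc k)) \<le> \<theta> * dist (b k) (a (Suc k))" for k
  proof -
    obtain j where j: "j \<in> I" "c \<in> C j" "a (Suc k) \<in> proj (C j) (b k)"
      using branch[OF near a, of "Suc k"] by (auto simp: x_def)
    have "dist (a (Suc k)) (b (Suc k)) \<le> friedrichs (C j) B * dist (b k) (a (Suc k))"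
      using alternating_step_contracts[OF C[OF j(1)] j(2) B bB j(3) b] .
    also have "\<dots> \<le> \<theta> * dist (b k) (a (Suc k))"
      using \<theta>(3)[OF j(1,2)] by (intro mult_right_mono) auto
    finally show ?thesis .
  qed
  \<comment> \<open>The next iterate may lie in another piece; it is compared with the projection \<open>a'\<close> onto the
    piece that contains \<open>a k\<close>.\<close>
  have half2: "dist (b k) (a (Suc k)) \<le> \<theta> * dist (a k) (b k)" for k
  proof -
    obtain j where j: "j \<in> I" "c \<in> C j" "a k \<in> proj (C j) (x k)"
      using branch[OF near a] by blast
    have "closed (C j)"
      using C[OF j(1)] by (rule affine_closed)
    then obtain a' where "a' \<in> C j" "infdist (b k) (C j) = dist (b k) a'"
      using infdist_attains_inf[of "C j" "b k"] j(2) by blast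
    then have a': "a' \<in> proj (C j) (b k)"
      by (simp add: proj_def dist_norm)
    have "dist (b k) (a (Suc k)) \<le> dist (b k) a'"
      using a[of "Suc k"] a' j(1) by (auto simp: proj_iff_dist A x_def)
    also have "\<dots> \<le> friedrichs B (C j) * dist (a k) (b k)"
      using alternating_step_contracts[OF B C[OF j(1)] j(2) _ b a'] j(3) by (simp add: proj_def)
    also have "\<dots> \<le> \<theta> * dist (a k) (b k)"
      using \<theta>(3)[OF j(1,2)] by (intro mult_right_mono) (auto simp: friedrichs_commute)
    finally show ?thesis .
  qed
  define q D where "q = \<theta>\<^sup>2" and "D = dist (b 0) (a 1)"
  have q: "0 \<le> q" "q < 1"
    using \<theta> by (simp_all add: q_def power_less_one_iff abs_square_less_1)
  have gap: "dist (b k) (a (Suc k)) \<le> D * q ^ k" for k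
  proof (induction k)
    case (Suc k)
    have "dist (b (Suc k)) (a (Suc (Suc k))) \<le> \<theta> * (\<theta> * dist (b k) (a (Suc k)))"
      using half2[of "Suc k"] half1[of k] \<theta>(1) by (meson mult_left_mono order_trans)
    also have "\<dots> \<le> \<theta> * (\<theta> * (D * q ^ k))"
      using Suc \<theta>(1) by (intro mult_left_mono)
    finally show ?case
      by (simp add: q_def power2_eq_square mult_ac)
  qed (simp add: D_def)
  have D: "0 \<le> D"
    by (simp add: D_def)
  have ab: "dist (a (Suc k)) (b (Suc k)) \<le> D * q ^ k" for k
    using half1[of k] gap[of k] \<theta> by (meson less_imp_le mult_left_le_one_le order_trans zero_le_dist)
  have "dist (a (Suc k)) (a (Suc (Suc k))) \<le> (2 * D) * q ^ k" for k
  proof -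
    have "dist (b (Suc k)) (a (Suc (Suc k))) \<le> dist (a (Suc k)) (b (Suc k))"
      using half2[of "Suc k"] \<theta> by (meson less_imp_le mult_left_le_one_le order_trans zero_le_dist)
    then show ?thesis
      using ab[of k] dist_triangle[of "a (Suc k)" "a (Suc (Suc k))" "b (Suc k)"] by linarith
  qed
  from geometric_steps_converge[OF q this]
  obtain z where z: "(\<lambda>k. a (Suc k)) \<longlonglongrightarrow> z"
    and az: "\<And>k. dist (a (Suc k)) z \<le> 2 * D / (1 - q) * q ^ k"
    by blast
  define K where "K = D + 2 * D / (1 - q)"
  have K: "0 \<le> K"
    using D q by (simp add: K_def)
  have aK: "dist (a (Suc k)) z \<le> K * q ^ k" for k
    using az[of k] mult_nonneg_nonneg[OF D, of "q ^ k"] q by (simp add: K_def distrib_right)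
  have bK: "dist (b (Suc k)) z \<le> K * q ^ k" for k
    using az[of k] ab[of k] dist_triangle2[of "b (Suc k)" z "a (Suc k)"]
      dist_triangle[of "b (Suc k)" z "a (Suc k)"]
    by (simp add: K_def distrib_right dist_commute)
  have "(\<lambda>k. K * q ^ k) \<longlonglongrightarrow> 0"
    using q by (intro tendsto_mult_right_zero LIMSEQ_realpow_zero) auto
  then have "(\<lambda>k. dist (b (Suc k)) z) \<longlonglongrightarrow> 0"
    by (rule Lim_null_comparison[rotated]) (simp add: bK)
  then have bz: "(\<lambda>k. b (Suc k)) \<longlonglongrightarrow> z"
    by (rule tendsto_dist_iff[THEN iffD2])
  have "a k \<in> A" for k
    using a[of k] by (simp add: proj_def)
  then have "z \<in> A"
    using closed_sequentially[OF A(2) _ z] by simp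
  moreover have "z \<in> B"
    using closed_sequentially[OF affine_closed[OF B(1)] _ bz] bB by simp
  moreover have "norm (z - c) \<le> norm (y - c)"
  proof (rule tendsto_upperbound[OF tendsto_norm[OF tendsto_diff[OF bz tendsto_const[of c]]]])
    have "norm (b (Suc k) - c) \<le> norm (y - c)" for k
      using bounded[of "Suc (Suc k)"] by (simp add: x_def)
    then show "\<forall>\<^sub>F k in sequentially. norm (b (Suc k) - c) \<le> norm (y - c)"
      by simp
  qed simp
  moreover have "converge_linearly a b z q"
    unfolding converge_linearly_def
  proof (intro exI[of _ K] conjI K allI impI)
    fix k :: nat assume "1 \<le> k"
    then show "max (norm (a k - z)) (norm (b k - z)) \<le> K * q ^ (k - 1)"
      using aK[of "k - 1"] bK[of "k - 1"] by (simp add: dist_norm)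
  qed
  ultimately show ?thesis
    unfolding q_def by blast
qed

section \<open>Sparse vectors as a union of coordinate subspaces\<close>

lemma coord_subspace_eq:
  fixes J :: "'n::finite set"
  shows "coord_subspace J = {x. supp x \<subseteq> J}"
proof -
  have "coord_subspace J = {x :: real ^ 'n. \<forall>i\<in>Basis. i \<notin> (\<lambda>j. axis j 1) ` J \<longrightarrow> x \<bullet> i = 0}"
    unfolding coord_subspace_def by (rule span_substd_basis) (auto simp: Basis_vec_def)
  also have "\<dots> = {x. supp x \<subseteq> J}"
    by (auto simp: Basis_vec_def supp_def inner_axis axis_eq_axis image_iff)
  finally show ?thesis .
qed

lemma subspace_coord_subspace: "subspace (coord_subspace J)"
  by (simp add: coord_subspace_def)

lemma Union_coord_subspace:
  fixes s :: nat
  assumes "s \<le> CARD('n)"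
  shows "(\<Union>J\<in>{J. card J = s}. coord_subspace J) = {x :: real ^ 'n. l0norm x \<le> s}"
proof -
  have "\<exists>J. card J = s \<and> supp x \<subseteq> J" if "card (supp x) \<le> s" for x :: "real ^ 'n"
    using exists_subset_between[OF that assms] by auto
  moreover have "card (supp x) \<le> card J" if "supp x \<subseteq> J" for J and x :: "real ^ 'n"
    using that by (simp add: card_mono)
  ultimately show ?thesis
    by (auto simp: coord_subspace_eq l0norm_def)
qed

lemma infdist_coord_subspace_ge:
  assumes "j \<notin> J"
  shows "\<bar>c $ j\<bar> \<le> infdist c (coord_subspace J)"
proof -
  have "\<bar>c $ j\<bar> \<le> dist c x" if "x \<in> coord_subspace J" for x
  proof -
    have "x $ j = 0"
      using that assms by (auto simp: coord_subspace_eq supp_def)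
    then show ?thesis
      using component_le_norm_cart[of "c - x" j] by (simp add: dist_norm)
  qed
  moreover have "coord_subspace J \<noteq> {}"
    using subspace_0[OF subspace_coord_subspace] by blast
  ultimately show ?thesis
    by (simp add: infdist_notempty cINF_greatest)
qed

text \<open>Setting the coordinate \<open>j\<close> of \<open>c\<close> to zero yields a vector of the subspace.\<close>

lemma infdist_coord_subspace_le:
  assumes "supp c - {j} \<subseteq> J"
  shows "infdist c (coord_subspace J) \<le> \<bar>c $ j\<bar>"
proof -
  let ?x = "c - (c $ j) *\<^sub>R axis j 1"
  have "?x \<in> coord_subspace J"
    using assms by (auto simp: coord_subspace_eq supp_def axis_def)
  then have "infdist c (coord_subspace J) \<le> dist c ?x"
    by (rule infdist_le)
  then show ?thesis
    by (simp add: dist_norm norm_axis_1)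
qed

text \<open>For \<open>j\<close> in the support of \<open>c\<close>, the remaining support has fewer than \<open>s\<close> elements, and as \<open>s < CARD('n)\<close> it
  extends to a set of \<open>s\<close> indices that still avoids \<open>j\<close>; the corresponding subspace is within \<open>\<bar>c $ j\<bar>\<close> of \<open>c\<close>.
  Conversely, a subspace that misses \<open>c\<close> misses some coordinate of its support.\<close>

lemma INF_infdist_coord_subspace:
  fixes c :: "real ^ 'n"
  assumes "1 \<le> s" "s < CARD('n)" and c: "l0norm c \<le> s"
  shows "(INF J\<in>{J. card J = s \<and> c \<notin> coord_subspace J}. ereal (infdist c (coord_subspace J)))
    = (INF j\<in>supp c. ereal \<bar>c $ j\<bar>)"
proof (rule antisym)
  show "(INF J\<in>{J. card J = s \<and> c \<notin> coord_subspace J}. ereal (infdist c (coord_subspace J)))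
    \<le> (INF j\<in>supp c. ereal \<bar>c $ j\<bar>)"
  proof (rule INF_greatest)
    fix j assume j: "j \<in> supp c"
    have "card (supp c - {j}) \<le> s" "s \<le> card (UNIV - {j})"
      using assms j by (simp_all add: l0norm_def)
    then obtain J where J: "supp c - {j} \<subseteq> J" "J \<subseteq> UNIV - {j}" "card J = s"
      using exists_subset_between[of "supp c - {j}" s "UNIV - {j}"] by auto
    then have "c \<notin> coord_subspace J"
      using j by (auto simp: coord_subspace_eq)
    with J show "(INF J\<in>{J. card J = s \<and> c \<notin> coord_subspace J}. ereal (infdist c (coord_subspace J)))
      \<le> ereal \<bar>c $ j\<bar>"
      by (intro INF_lower2[of J]) (auto intro: infdist_coord_subspace_le)
  qed
  show "(INF j\<in>supp c. ereal \<bar>c $ j\<bar>)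
    \<le> (INF J\<in>{J. card J = s \<and> c \<notin> coord_subspace J}. ereal (infdist c (coord_subspace J)))"
  proof (rule INF_greatest)
    fix J assume "J \<in> {J. card J = s \<and> c \<notin> coord_subspace J}"
    then obtain j where "j \<in> supp c" "j \<notin> J"
      by (auto simp: coord_subspace_eq)
    then show "(INF j\<in>supp c. ereal \<bar>c $ j\<bar>) \<le> ereal (infdist c (coord_subspace J))"
      by (intro INF_lower2[of j]) (auto intro: infdist_coord_subspace_ge)
  qed
qed

section \<open>The joint CQ-numbers of sparsity and a linear system\<close>

lemma affine_linear_system: "affine {x. (M :: real ^ 'n ^ 'm) *v x = p}"
  by (auto simp: affine_def matrix_vector_right_distrib matrix_vector_mult_scaleR simp flip: scaleR_left_distrib)

lemma SUP_ereal_eq_Max: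
  fixes f :: "'i \<Rightarrow> real" and G :: "'i \<Rightarrow> 'j \<Rightarrow> ereal"
  assumes "finite I" "i\<^sub>0 \<in> I" "P i\<^sub>0"
    and G: "\<And>i j. i \<in> I \<Longrightarrow> G i j = (if P i then ereal (f i) else - \<infinity>)"
  shows "(SUP (i, j)\<in>I \<times> UNIV. G i j) = ereal (Max {f i | i. P i \<and> i \<in> I})"
proof -
  have fin: "finite {f i | i. P i \<and> i \<in> I}" and ne: "{f i | i. P i \<and> i \<in> I} \<noteq> {}"
    using assms by auto
  show ?thesis
  proof (rule antisym)
    show "(SUP (i, j)\<in>I \<times> UNIV. G i j) \<le> ereal (Max {f i | i. P i \<and> i \<in> I})"
      by (intro SUP_least) (auto simp: G intro!: Max_ge[OF fin])
    obtain i where "Max {f i | i. P i \<and> i \<in> I} = f i" "P i" "i \<in> I"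
      using Max_in[OF fin ne] by blast
    then show "ereal (Max {f i | i. P i \<and> i \<in> I}) \<le> (SUP (i, j)\<in>I \<times> UNIV. G i j)"
      by (intro SUP_upper2[of "(i, undefined)"]) (auto simp: G)
  qed
qed

theorem theorem3p19:
  fixes M :: "real ^ 'n ^ 'm" and p :: "real ^ 'm" and s :: nat
    and c :: "real ^ 'n" and \<delta> :: real
    and JJ :: "'n set set" and A B :: "(real ^ 'n) set"
    and \<B> :: "unit \<Rightarrow> (real ^ 'n) set"
    and \<delta>bar \<alpha>bar \<theta>bar \<theta>3\<delta> :: ereal
  assumes "1 \<le> CARD('m)" and "CARD('m) < CARD('n)"
    and "1 \<le> s" and "s \<le> CARD('n) - 1"
    and JJ: "JJ = {J. card J = s}"
    and A: "A = (\<Union>J\<in>JJ. coord_subspace J)"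
    and B: "B = {x. M *v x = p}"
    and \<B>: "\<B> = (\<lambda>_. B)"
    and c: "c \<in> A \<inter> B"
    and \<delta>bar: "\<delta>bar =
      ereal (1/3) * (INF J\<in>{J \<in> JJ. c \<notin> coord_subspace J}. ereal (infdist c (coord_subspace J)))"
    and \<delta>: "0 < \<delta>" "ereal \<delta> < \<delta>bar"
    and \<theta>3\<delta>: "\<theta>3\<delta> =
      joint_CQ_number c (3 * \<delta>) JJ UNIV coord_subspace coord_subspace \<B> \<B>"
    and \<theta>bar: "\<theta>bar =
      limiting_joint_CQ_number c JJ UNIV coord_subspace coord_subspace \<B> \<B>"
    and \<alpha>bar: "\<alpha>bar =
      exact_joint_CQ_number c JJ UNIV coord_subspace coord_subspace \<B> \<B>"
  shows "A = {x. l0norm x \<le> s}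
    \<and> \<delta>bar = ereal (1/3) * (INF j\<in>supp c. ereal \<bar>c $ j\<bar>)
    \<and> \<alpha>bar = \<theta>bar
    \<and> \<theta>bar = \<theta>3\<delta>
    \<and> \<theta>3\<delta> = ereal (Max {friedrichs (coord_subspace J) B | J. c \<in> coord_subspace J \<and> J \<in> JJ})
    \<and> Max {friedrichs (coord_subspace J) B | J. c \<in> coord_subspace J \<and> J \<in> JJ} < 1
    \<and> (\<forall>y a b.
         norm (y - c) \<le> (1 - real_of_ereal \<theta>bar) * \<delta> / (6 * (2 - real_of_ereal \<theta>bar)) \<longrightarrow>
         MAP_sequences A B y a b \<longrightarrow>
         (\<exists>cbar \<in> A \<inter> B. norm (cbar - c) \<le> \<delta> \<and>
            converge_linearly a b cbar ((real_of_ereal \<theta>bar)\<^sup>2)))"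
proof -
  have affJ: "affine (coord_subspace J)" for J :: "'n set"
    by (intro subspace_imp_affine subspace_coord_subspace)
  have neJ: "coord_subspace J \<noteq> {}" for J :: "'n set"
    using subspace_0[OF subspace_coord_subspace] by blast
  have affB: "affine B"
    unfolding B by (rule affine_linear_system)
  have cB: "c \<in> B" and cA: "c \<in> A"
    using c by auto
  have s: "s < CARD('n)"
    using assms(1,2,4) by linarith
  have A_eq: "A = {x. l0norm x \<le> s}"
    unfolding A JJ using s by (intro Union_coord_subspace) simp
  have \<delta>bar_eq: "\<delta>bar = ereal (1/3) * (INF j\<in>supp c. ereal \<bar>c $ j\<bar>)"
    using INF_infdist_coord_subspace[OF assms(3) s, of c] cA by (simp add: \<delta>bar JJ A_eq)
  have sep: "3 * \<delta> < infdist c (coord_subspace J)" if "J \<in> JJ" "c \<notin> coord_subspace J" for J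
  proof -
    have "\<delta>bar \<le> ereal (1/3) * ereal (infdist c (coord_subspace J))"
      unfolding \<delta>bar using that by (intro ereal_mult_left_mono INF_lower) auto
    then have "ereal \<delta> < ereal (1/3) * ereal (infdist c (coord_subspace J))"
      using \<delta>(2) by (rule less_le_trans[rotated])
    then show ?thesis
      by simp
  qed
  define \<theta> where "\<theta> = Max {friedrichs (coord_subspace J) B | J. c \<in> coord_subspace J \<and> J \<in> JJ}"
  obtain J\<^sub>0 where J\<^sub>0: "J\<^sub>0 \<in> JJ" "c \<in> coord_subspace J\<^sub>0"
    using cA A by auto
  have joint: "joint_CQ_number c \<epsilon> JJ UNIV coord_subspace coord_subspace \<B> \<B> = ereal \<theta>"
    if "0 < \<epsilon>" "\<epsilon> \<le> 3 * \<delta>" for \<epsilon>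
    unfolding joint_CQ_number_def \<theta>_def \<B>
  proof (rule SUP_ereal_eq_Max[where P = "\<lambda>J. c \<in> coord_subspace J", OF _ J\<^sub>0])
    fix J assume "J \<in> JJ"
    then show "CQ_number c \<epsilon> (coord_subspace J) (coord_subspace J) B B
      = (if c \<in> coord_subspace J then ereal (friedrichs (coord_subspace J) B) else - \<infinity>)"
      using CQ_number_affine[OF affJ _ affB cB that(1), of J] sep[of J] that(2)
      by (auto intro: CQ_number_eq_minus_infty)
  qed simp
  have "exact_joint_CQ_number c JJ UNIV coord_subspace coord_subspace \<B> \<B> = ereal \<theta>"
    unfolding exact_joint_CQ_number_def \<theta>_def \<B>
    by (rule SUP_ereal_eq_Max[where P = "\<lambda>J. c \<in> coord_subspace J", OF _ J\<^sub>0])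
      (auto simp: exact_CQ_number_affine[OF affJ _ affB cB] exact_CQ_number_eq_minus_infty)
  then have \<alpha>bar_eq: "\<alpha>bar = ereal \<theta>"
    by (simp add: \<alpha>bar)
  have \<theta>3\<delta>_eq: "\<theta>3\<delta> = ereal \<theta>"
    using \<delta>(1) by (simp add: \<theta>3\<delta> joint)
  have "\<forall>\<^sub>F \<epsilon> in at_right 0. joint_CQ_number c \<epsilon> JJ UNIV coord_subspace coord_subspace \<B> \<B> = ereal \<theta>"
    unfolding eventually_at_right_field using \<delta>(1) by (intro exI[of _ "3 * \<delta>"]) (auto intro: joint)
  then have \<theta>bar_eq: "\<theta>bar = ereal \<theta>"
    unfolding \<theta>bar limiting_joint_CQ_number_def by (intro tendsto_Lim tendsto_eventually) simp_all
  have fin: "finite {friedrichs (coord_subspace J) B | J. c \<in> coord_subspace J \<and> J \<in> JJ}"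
    by simp
  have le_\<theta>: "friedrichs (coord_subspace J) B \<le> \<theta>" if "J \<in> JJ" "c \<in> coord_subspace J" for J
    unfolding \<theta>_def using that by (intro Max_ge[OF fin]) auto
  have \<theta>1: "\<theta> < 1"
    unfolding \<theta>_def using J\<^sub>0 cB
    by (subst Max_less_iff[OF fin]) (auto intro: friedrichs_less_1[OF affJ neJ affB])
  have \<theta>0: "0 \<le> \<theta>"
    using le_\<theta>[OF J\<^sub>0] friedrichs_nonneg[OF affJ neJ affB, of J\<^sub>0] cB by force
  have "closed A"
    unfolding A by (intro closed_UN ballI closed_subspace subspace_coord_subspace) simp
  have MAP: "\<exists>cbar\<in>A \<inter> B. norm (cbar - c) \<le> \<delta> \<and> converge_linearly a b cbar (\<theta>\<^sup>2)"
    if y: "norm (y - c) \<le> (1 - \<theta>) * \<delta> / (6 * (2 - \<theta>))" and "MAP_sequences A B y a b" for y a b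
  proof -
    have "(1 - \<theta>) * \<delta> / (6 * (2 - \<theta>)) \<le> \<delta>"
      using \<theta>1 \<theta>0 \<delta>(1) mult_right_mono[of "1 - \<theta>" "6 * (2 - \<theta>)" \<delta>] by (simp add: divide_le_eq mult_ac)
    then have y': "norm (y - c) \<le> \<delta>"
      using y by linarith
    then have "2 * norm (y - c) < 3 * \<delta>"
      using \<delta>(1) by linarith
    then have "\<exists>z\<in>A \<inter> B. norm (z - c) \<le> norm (y - c) \<and> converge_linearly a b z (\<theta>\<^sup>2)"
      using sep le_\<theta> that(2)
      by (intro MAP_union_affine_converges_linearly[OF A \<open>closed A\<close> affJ affB cB cA _ \<theta>0 \<theta>1])
        (auto intro: less_imp_le)
    then show ?thesis
      using y' by (meson order_trans)
  qed
  show ?thesis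
    using A_eq \<delta>bar_eq \<alpha>bar_eq \<theta>bar_eq \<theta>3\<delta>_eq \<theta>1 MAP by (simp add: \<theta>_def)
qed

end
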